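(* Let $l\in\mathbb{N}$, let $k_1<k_2$ be arbitrary real numbers and let $f:\mathbb{Q}^l\rightarrow X$ be an arbitrary function with values in a compact metric space $X$. For any $\varepsilon>0$, $k\in\mathbb{N}$ and non-empty finite set $F\subseteq\mathbb{Q}^l$ there exist $\alpha\in\mathbb{Q}^l$, $\beta\in\mathbb{Q}\setminus\mathbb{Z}$ and $\gamma\in\mathbb{Z}^\ast$ with $dom^+(\beta)=\emptyset=dom^-(\gamma)$ and $\max dom^-(\beta)<k_1<k_2<\min dom^+(\gamma)$ such that $diam\big(f(\alpha+(p\beta+q\gamma)F)\big)<\varepsilon$ for all integers $0\leq p,q\leq k$.
   Context: Notation: $\mathbb{N}=\{1,2,\ldots\}$, $\mathbb{Z}^\ast=\mathbb{Z}\setminus\{0\}$; for $\alpha\in\mathbb{Q}^l$, $c\in\mathbb{Q}$ and $F\subseteq\mathbb{Q}^l$, $\alpha+cF=\{\alpha+cf: f\in F\}$; $diam(A)=\sup\{d(x,y): x,y\in A\}$, where $d$ is the metric. Expansion of rationals: every rational number $q$ has a unique expression $q=\sum_{s=1}^{\infty}q_{-s}\frac{(-1)^{s}}{(s+1)!}+\sum_{r=1}^{\infty}q_{r}(-1)^{r+1}r!$ with integers $0\leq q_{-s}\leq s$ for $s\geq 1$ and $0\leq q_r\leq r$ for $r\geq 1$, all but finitely many of which are zero. Put $dom(q)=\{t\in\mathbb{Z}^\ast: q_t\neq 0\}$, $dom^-(q)=\{t\in dom(q): t<0\}$, $dom^+(q)=\{t\in dom(q): t>0\}$. *)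

theory Defs
  imports "HOL-Analysis.Analysis"
begin

text \<open>
  A digit sequence is indexed by all integers. The index 0 is not used by the expansion;
  requiring \<open>d 0 = 0\<close> makes the sequence unique as a function. The two series are written as
  sums over the (finite) sets of indices with non-zero digit.
\<close>

definition is_expansion :: "(int \<Rightarrow> int) \<Rightarrow> rat \<Rightarrow> bool" where
  "is_expansion d q \<longleftrightarrow>
     d 0 = 0 \<and>
     (\<forall>s::nat. 1 \<le> s \<longrightarrow> 0 \<le> d (- int s) \<and> d (- int s) \<le> int s) \<and>
     (\<forall>r::nat. 1 \<le> r \<longrightarrow> 0 \<le> d (int r) \<and> d (int r) \<le> int r) \<and>
     finite {t. d t \<noteq> 0} \<and>
     q = (\<Sum>s::nat | 1 \<le> s \<and> d (- int s) \<noteq> 0. of_int (d (- int s)) * ((- 1) ^ s / fact (s + 1)))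
       + (\<Sum>r::nat | 1 \<le> r \<and> d (int r) \<noteq> 0. of_int (d (int r)) * ((- 1) ^ (r + 1) * fact r))"

text \<open>Well-defined by \<open>ex1_expansion\<close> below.\<close>

definition digit :: "rat \<Rightarrow> int \<Rightarrow> int" where
  "digit q = (THE d. is_expansion d q)"

definition digit_dom :: "rat \<Rightarrow> int set" where
  "digit_dom q = {t. t \<noteq> 0 \<and> digit q t \<noteq> 0}"

definition dom_neg :: "rat \<Rightarrow> int set" where
  "dom_neg q = {t \<in> digit_dom q. t < 0}"

definition dom_pos :: "rat \<Rightarrow> int set" where
  "dom_pos q = {t \<in> digit_dom q. t > 0}"

definition affine_image :: "rat ^ 'n \<Rightarrow> rat \<Rightarrow> (rat ^ 'n) set \<Rightarrow> (rat ^ 'n) set" where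
  "affine_image \<alpha> c F = {\<alpha> + c *s x | x. x \<in> F}"


subsection \<open>Existence and uniqueness of the expansion\<close>

lemma is_expansion_bounded:
  assumes "d 0 = 0"
    and "\<And>s::nat. 1 \<le> s \<Longrightarrow> 0 \<le> d (- int s) \<and> d (- int s) \<le> int s"
    and "\<And>r::nat. 1 \<le> r \<Longrightarrow> 0 \<le> d (int r) \<and> d (int r) \<le> int r"
    and supp: "\<And>t. \<bar>t\<bar> > int n \<Longrightarrow> d t = 0"
  shows "is_expansion d q \<longleftrightarrow>
     q = (\<Sum>s=1..n. of_int (d (- int s)) * ((- 1) ^ s / fact (s + 1)))
       + (\<Sum>r=1..n. of_int (d (int r)) * ((- 1) ^ (r + 1) * fact r))"
proof -
  have "{t. d t \<noteq> 0} \<subseteq> {- int n..int n}"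
    using supp by (force simp: not_less[symmetric])
  then have fin: "finite {t. d t \<noteq> 0}"
    by (rule finite_subset) simp
  have 1: "(\<Sum>s::nat | 1 \<le> s \<and> d (- int s) \<noteq> 0. of_int (d (- int s)) * ((- 1) ^ s / fact (s + 1)))
      = (\<Sum>s=1..n. of_int (d (- int s)) * ((- 1) ^ s / fact (s + 1)) :: rat)"
  proof (rule sum.mono_neutral_left)
    show "{s. 1 \<le> s \<and> d (- int s) \<noteq> 0} \<subseteq> {1..n}"
      using supp[of "- int s" for s] by (force simp: not_less[symmetric])
  qed auto
  have 2: "(\<Sum>r::nat | 1 \<le> r \<and> d (int r) \<noteq> 0. of_int (d (int r)) * ((- 1) ^ (r + 1) * fact r))
      = (\<Sum>r=1..n. of_int (d (int r)) * ((- 1) ^ (r + 1) * fact r) :: rat)"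
  proof (rule sum.mono_neutral_left)
    show "{r. 1 \<le> r \<and> d (int r) \<noteq> 0} \<subseteq> {1..n}"
      using supp[of "int s" for s] by (force simp: not_less[symmetric])
  qed auto
  show ?thesis
    unfolding is_expansion_def 1 2 using assms fin by blast
qed

lemma is_expansion_supp_bounded:
  assumes "is_expansion d q"
  obtains n where "\<And>t. \<bar>t\<bar> > int n \<Longrightarrow> d t = 0"
proof -
  have "finite (abs ` {t. d t \<noteq> 0})"
    using assms by (simp add: is_expansion_def)
  then obtain B where B: "\<forall>x \<in> abs ` {t. d t \<noteq> 0}. x \<le> B"
    by (meson Max_ge)
  have "d t = 0" if "\<bar>t\<bar> > int (nat B)" for t
  proof (rule ccontr)
    assume "d t \<noteq> 0"
    then have "\<bar>t\<bar> \<le> B" using B by blast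
    then show False using that by linarith
  qed
  then show ?thesis using that by blast
qed

lemma neg_digits_exist:
  "\<exists>M a. (\<forall>s. 0 \<le> a s \<and> a s \<le> int s) \<and> (\<forall>s>n. a s = 0) \<and>
     (of_int N / fact (n + 1) :: rat)
       = of_int M + (\<Sum>s=1..n. of_int (a s) * ((- 1) ^ s / fact (s + 1)))"
proof (induction n arbitrary: N)
  case 0
  show ?case by (rule exI[of _ N], rule exI[of _ "\<lambda>_. 0"]) simp
next
  case (Suc n)
  define e :: int where "e = (- 1) ^ Suc n"
  define c where "c = (e * N) mod (int n + 2)"
  define N' where "N' = e * ((e * N) div (int n + 2))"
  have ee: "e * e = 1" by (simp add: e_def flip: power_mult_distrib)
  have c: "0 \<le> c" "c \<le> int n + 1"
    using pos_mod_bound[of "int n + 2" "e * N"] pos_mod_sign[of "int n + 2" "e * N"] unfolding c_def by linarith+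
  have "e * N = (int n + 2) * ((e * N) div (int n + 2)) + c"
    by (simp add: c_def)
  then have "(e * e) * N = (int n + 2) * N' + e * c"
    unfolding N'_def by algebra
  then have N: "N = (int n + 2) * N' + e * c"
    unfolding ee by simp
  obtain M a where a: "\<forall>s. 0 \<le> a s \<and> a s \<le> int s" "\<forall>s>n. a s = 0"
     and eq: "(of_int N' / fact (n + 1) :: rat)
       = of_int M + (\<Sum>s=1..n. of_int (a s) * ((- 1) ^ s / fact (s + 1)))"
    using Suc.IH[of N'] by blast
  have f: "fact (Suc n + 1) = (of_nat n + 2) * (fact (n + 1) :: rat)"
    by (simp add: algebra_simps)
  have nz: "of_nat n + 2 \<noteq> (0 :: rat)"
    by (metis of_nat_eq_0_iff of_nat_add of_nat_numeral add_is_0 zero_neq_numeral)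
  have "(of_int N / fact (Suc n + 1) :: rat)
      = ((of_nat n + 2) * of_int N') / ((of_nat n + 2) * fact (n + 1)) + of_int (e * c) / fact (Suc n + 1)"
    unfolding f by (subst N) (simp add: add_divide_distrib)
  also have "\<dots> = of_int N' / fact (n + 1) + of_int c * ((- 1) ^ Suc n / fact (Suc n + 1))"
    using nz by (simp add: e_def)
  also have "\<dots> = of_int M + (\<Sum>s=1..Suc n. of_int ((a(Suc n := c)) s) * ((- 1) ^ s / fact (s + 1)))"
    unfolding eq by simp
  finally have "(of_int N / fact (Suc n + 1) :: rat) = \<dots>" .
  moreover have "\<forall>s. 0 \<le> (a(Suc n := c)) s \<and> (a(Suc n := c)) s \<le> int s" using a c by auto
  moreover have "\<forall>s>Suc n. (a(Suc n := c)) s = 0" using a by auto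
  ultimately show ?case by blast
qed

lemma pos_digits_exist:
  fixes m :: int
  assumes "1 \<le> r"
  shows "\<exists>b n. (\<forall>i. 0 \<le> b i \<and> b i \<le> int i) \<and> (\<forall>i. i < r \<or> n < i \<longrightarrow> b i = 0) \<and>
     m * ((- 1) ^ (r + 1) * fact r) = (\<Sum>i=1..n. b i * ((- 1) ^ (i + 1) * fact i))"
  using assms
proof (induction "nat (if m > 0 then 2 * m else 1 - 2 * m)" arbitrary: m r rule: less_induct)
  case less
  show ?case
  proof (cases "m = 0")
    case True
    then show ?thesis by (intro exI[of _ "\<lambda>_. 0"]) simp
  next
    case False
    define c where "c = m mod (int r + 1)"
    define m' where "m' = - (m div (int r + 1))"
    have c: "0 \<le> c" "c \<le> int r"
      using pos_mod_bound[of "int r + 1" m] less.prems by (simp_all add: c_def)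
    have m: "m = c - (int r + 1) * m'"
      by (simp add: c_def m'_def)
    have "nat (if m' > 0 then 2 * m' else 1 - 2 * m') < nat (if m > 0 then 2 * m else 1 - 2 * m)"
    proof (cases "m > 0")
      case True
      have "m div (int r + 1) \<ge> 0" using True by (simp add: pos_imp_zdiv_nonneg_iff)
      moreover have "m div (int r + 1) < m"
        using True less.prems by (intro int_div_less_self) auto
      ultimately show ?thesis using True by (simp add: m'_def)
    next
      case neg: False
      have "m' \<ge> 0" using neg m c less.prems
        by (smt (verit) mult_pos_neg of_nat_0_le_iff mult_minus_right)
      moreover have "m' \<le> - m"
      proof (rule ccontr)
        assume "\<not> m' \<le> - m"
        then have "(int r + 1) * m' \<ge> (int r + 1) * (1 - m)" by (intro mult_left_mono) auto
        also have "(int r + 1) * (1 - m) = int r + 1 - m - int r * m" by (simp add: algebra_simps)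
        finally have "(int r + 1) * m' \<ge> int r + 1 - m - int r * m" .
        moreover have "int r * m \<le> 0" using neg by (simp add: mult_nonneg_nonpos)
        ultimately show False using m c by linarith
      qed
      ultimately show ?thesis using neg \<open>m \<noteq> 0\<close> by simp
    qed
    from less.hyps[OF this, of "Suc r"] obtain b n
      where b: "\<forall>i. 0 \<le> b i \<and> b i \<le> int i" "\<forall>i. i < Suc r \<or> n < i \<longrightarrow> b i = 0"
      and eq: "m' * ((- 1) ^ (Suc r + 1) * fact (Suc r)) = (\<Sum>i=1..n. b i * ((- 1) ^ (i + 1) * fact i))"
      by auto
    define k where "k = max n r"
    have "m * ((- 1) ^ (r + 1) * fact r)
        = c * ((- 1) ^ (r + 1) * fact r) + m' * ((- 1) ^ (Suc r + 1) * fact (Suc r))"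
      by (subst m) (simp add: algebra_simps)
    also have "m' * ((- 1) ^ (Suc r + 1) * fact (Suc r)) = (\<Sum>i=1..k. b i * ((- 1) ^ (i + 1) * fact i))"
      unfolding eq by (rule sum.mono_neutral_left) (use b in \<open>auto simp: k_def\<close>)
    also have "c * ((- 1) ^ (r + 1) * fact r) = (\<Sum>i=1..k. if i = r then c * ((- 1) ^ (i + 1) * fact i) else 0)"
      using less.prems by (simp add: k_def sum.delta)
    also have "\<dots> + (\<Sum>i=1..k. b i * ((- 1) ^ (i + 1) * fact i))
        = (\<Sum>i=1..k. (b(r := c)) i * ((- 1) ^ (i + 1) * fact i))"
      unfolding sum.distrib[symmetric] by (rule sum.cong) (use b in auto)
    finally have "m * ((- 1) ^ (r + 1) * fact r) = \<dots>" .
    moreover have "\<forall>i. 0 \<le> (b(r := c)) i \<and> (b(r := c)) i \<le> int i" using b c by auto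
    moreover have "\<forall>i. i < r \<or> k < i \<longrightarrow> (b(r := c)) i = 0" using b by (auto simp: k_def)
    ultimately show ?thesis by blast
  qed
qed

lemma expansion_exists: "\<exists>d. is_expansion d q"
proof -
  obtain u v :: int where q: "q = of_int u / of_int v" "v > 0"
    by (metis Fract_of_int_quotient Rat_cases)
  define n where "n = nat v"
  have "v dvd fact (n + 1)"
  proof -
    have "n dvd fact (n + 1)" using q by (intro dvd_fact) (auto simp: n_def)
    then have "int n dvd int (fact (n + 1))" by (simp only: of_nat_dvd_iff)
    moreover have "int n = v" using q by (simp add: n_def)
    ultimately show ?thesis by (simp only: of_nat_fact)
  qed
  then obtain w where w: "fact (n + 1) = v * w" ..
  have "(fact (n + 1) :: rat) = of_int (fact (n + 1))" by simp
  also have "\<dots> = of_int v * of_int w" unfolding w by simp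
  finally have fw: "(fact (n + 1) :: rat) = of_int v * of_int w" .
  have "w \<noteq> 0" using w fact_nonzero[of "n + 1", where ?'a = int] by auto
  then have qN: "q = of_int (u * w) / fact (n + 1)"
    unfolding fw q by simp
  obtain M a where a: "\<forall>s. 0 \<le> a s \<and> a s \<le> int s" "\<forall>s>n. a s = 0"
     and aeq: "q = of_int M + (\<Sum>s=1..n. of_int (a s) * ((- 1) ^ s / fact (s + 1)))"
    unfolding qN using neg_digits_exist[where N = "u * w" and n = n] by blast
  obtain b k where b: "\<forall>i. 0 \<le> b i \<and> b i \<le> int i" "\<forall>i. k < i \<longrightarrow> b i = 0"
    and "M = (\<Sum>i=1..k. b i * ((- 1) ^ (i + 1) * fact i))"
    using pos_digits_exist[of 1 M] by (auto simp: numeral_2_eq_2)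
  then have beq: "of_int M = (\<Sum>i=1..k. of_int (b i) * ((- 1) ^ (i + 1) * fact i) :: rat)"
    by simp
  define d where "d t = (if t < 0 then a (nat (- t)) else b (nat t))" for t
  define l where "l = max n k"
  have "is_expansion d q"
  proof (subst is_expansion_bounded[where n = l])
    show "d 0 = 0" using b by (auto simp: d_def intro: order_antisym dest: spec[of _ 0])
    show "0 \<le> d (- int s) \<and> d (- int s) \<le> int s" if "1 \<le> s" for s
      using a that by (auto simp: d_def)
    show "0 \<le> d (int s) \<and> d (int s) \<le> int s" if "1 \<le> s" for s
      using b that by (auto simp: d_def)
    show "d t = 0" if "\<bar>t\<bar> > int l" for t
      using a b that by (auto simp: d_def l_def)
    have "(\<Sum>s=1..n. of_int (a s) * ((- 1) ^ s / fact (s + 1)) :: rat)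
        = (\<Sum>s=1..l. of_int (a s) * ((- 1) ^ s / fact (s + 1)))"
      by (rule sum.mono_neutral_left) (use a in \<open>auto simp: l_def\<close>)
    also have "\<dots> = (\<Sum>s=1..l. of_int (d (- int s)) * ((- 1) ^ s / fact (s + 1)))"
      by (rule sum.cong) (auto simp: d_def)
    finally have 1: "(\<Sum>s=1..n. of_int (a s) * ((- 1) ^ s / fact (s + 1)) :: rat) = \<dots>" .
    have "(\<Sum>i=1..k. of_int (b i) * ((- 1) ^ (i + 1) * fact i) :: rat)
        = (\<Sum>i=1..l. of_int (b i) * ((- 1) ^ (i + 1) * fact i))"
      by (rule sum.mono_neutral_left) (use b in \<open>auto simp: l_def\<close>)
    also have "\<dots> = (\<Sum>i=1..l. of_int (d (int i)) * ((- 1) ^ (i + 1) * fact i))"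
      by (rule sum.cong) (auto simp: d_def)
    finally have 2: "(\<Sum>i=1..k. of_int (b i) * ((- 1) ^ (i + 1) * fact i) :: rat) = \<dots>" .
    show "q = (\<Sum>s=1..l. of_int (d (- int s)) * ((- 1) ^ s / fact (s + 1)))
       + (\<Sum>r=1..l. of_int (d (int r)) * ((- 1) ^ (r + 1) * fact r))"
      using aeq beq unfolding 1 2 by simp
  qed
  then show ?thesis by blast
qed

lemma neg_digits_unique:
  fixes e :: "nat \<Rightarrow> int"
  assumes "\<And>s. 1 \<le> s \<Longrightarrow> \<bar>e s\<bar> \<le> int s"
    and "(\<Sum>s=1..n. of_int (e s) * ((- 1) ^ s / fact (s + 1)) :: rat) = of_int M"
    and "1 \<le> s" "s \<le> n"
  shows "e s = 0"
  using assms(2-)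
proof (induction n arbitrary: s)
  case 0
  then show ?case by simp
next
  case (Suc n)
  have int: "(\<Sum>s=1..n. of_int (e s) * ((- 1) ^ s / fact (s + 1)) :: rat) * fact (n + 1) \<in> \<int>"
    unfolding sum_distrib_right
  proof (rule Ints_sum)
    fix s assume "s \<in> {1..n}"
    then have "fact (s + 1) dvd (fact (n + 1) :: int)" by (intro fact_dvd) simp
    then obtain w :: int where w: "fact (n + 1) = fact (s + 1) * w" ..
    have "(fact (n + 1) :: rat) = of_int (fact (n + 1))" by simp
    also have "\<dots> = fact (s + 1) * of_int w" unfolding w by simp
    finally have "of_int (e s) * ((- 1) ^ s / fact (s + 1)) * fact (n + 1)
        = (of_int (e s * (- 1) ^ s * w) :: rat)" by simp
    then show "of_int (e s) * ((- 1) ^ s / fact (s + 1)) * fact (n + 1) \<in> (\<int> :: rat set)"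
      by (metis Ints_of_int)
  qed
  then obtain T where T:
    "(\<Sum>s=1..n. of_int (e s) * ((- 1) ^ s / fact (s + 1)) :: rat) * fact (n + 1) = of_int T"
    by (auto elim: Ints_cases)
  have f: "fact (Suc n + 1) = (of_nat n + 2) * (fact (n + 1) :: rat)"
    by (simp add: algebra_simps)
  have nz: "of_nat n + 2 \<noteq> (0 :: rat)"
    by (metis of_nat_eq_0_iff of_nat_add of_nat_numeral add_is_0 zero_neq_numeral)
  let ?S = "\<Sum>s=1..n. of_int (e s) * ((- 1) ^ s / fact (s + 1)) :: rat"
  have "?S + of_int (e (Suc n)) * ((- 1) ^ Suc n / fact (Suc n + 1)) = of_int M"
    using Suc.prems(1) by simp
  then have "(?S + of_int (e (Suc n)) * ((- 1) ^ Suc n / fact (Suc n + 1))) * fact (Suc n + 1)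
      = of_int M * fact (Suc n + 1)" by (simp only:)
  then have "?S * fact (Suc n + 1) + of_int (e (Suc n)) * (- 1) ^ Suc n
      = of_int M * fact (Suc n + 1)" 
    by (simp only: distrib_right) (simp del: power_Suc fact_Suc)
  then have "of_int T * (of_nat n + 2) + of_int (e (Suc n)) * (- 1) ^ Suc n
      = (of_int M * (of_nat n + 2) * fact (n + 1) :: rat)"
    unfolding f T[symmetric] by (simp only: mult_ac)
  then have "(of_int (T * (int n + 2) + e (Suc n) * (- 1) ^ Suc n) :: rat)
      = of_int (M * (int n + 2) * fact (n + 1))"
    by (simp del: fact_Suc power_Suc)
  then have "T * (int n + 2) + e (Suc n) * (- 1) ^ Suc n = M * (int n + 2) * fact (n + 1)"
    by (simp only: of_int_eq_iff)
  then have "e (Suc n) * (- 1) ^ Suc n = (int n + 2) * (M * fact (n + 1) - T)"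
    by (simp only: algebra_simps)
  then have "int n + 2 dvd e (Suc n) * (- 1) ^ Suc n" by simp
  then have "int n + 2 dvd e (Suc n)"
    by (cases "even n") auto
  moreover have "\<bar>e (Suc n)\<bar> < int n + 2" using assms(1)[of "Suc n"] by simp
  ultimately have 0: "e (Suc n) = 0" using dvd_imp_le_int[of "e (Suc n)" "int n + 2"] by fastforce
  then have "?S = of_int M" using Suc.prems(1) by simp
  then show ?case using Suc.IH[of s] Suc.prems 0 by (cases "s = Suc n") auto
qed

lemma pos_digits_unique:
  fixes e :: "nat \<Rightarrow> int"
  assumes e: "\<And>r. 1 \<le> r \<Longrightarrow> \<bar>e r\<bar> \<le> int r"
    and sum0: "(\<Sum>r=1..n. e r * ((- 1) ^ (r + 1) * fact r)) = 0"
    and "1 \<le> r" "r \<le> n"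
  shows "e r = 0"
  using assms(3-)
proof (induction r rule: less_induct)
  case (less r)
  let ?g = "\<lambda>r. e r * ((- 1) ^ (r + 1) * fact r)"
  have "(\<Sum>r=1..n. ?g r) = ?g r + (\<Sum>r \<in> {1..n} - {r}. ?g r)"
    using less.prems by (intro sum.remove) auto
  moreover have "fact (Suc r) dvd (\<Sum>r \<in> {1..n} - {r}. ?g r)"
  proof (rule dvd_sum)
    fix i assume i: "i \<in> {1..n} - {r}"
    show "fact (Suc r) dvd ?g i"
    proof (cases "i < r")
      case True
      then show ?thesis using less.IH[of i] i by simp
    next
      case False
      then have "fact (Suc r) dvd (fact i :: int)" using i by (intro fact_dvd) auto
      then show ?thesis by (metis dvd_mult)
    qed
  qed
  ultimately have "fact (Suc r) dvd ?g r"
    using sum0 dvd_add_left_iff[of "fact (Suc r)" "\<Sum>r \<in> {1..n} - {r}. ?g r" "?g r"]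
    by (simp del: fact_Suc)
  moreover have "?g r = (e r * (- 1) ^ (r + 1)) * fact r"
    by (simp only: mult.assoc)
  moreover have "fact (Suc r) = (int r + 1) * fact r"
    by (simp add: algebra_simps)
  ultimately have "int r + 1 dvd e r * (- 1) ^ (r + 1)"
    by (metis dvd_mult_cancel_right fact_nonzero)
  then have "int r + 1 dvd e r"
    by (cases "even r") auto
  moreover have "\<bar>e r\<bar> < int r + 1" using e[of r] less.prems by simp
  ultimately show ?case using dvd_imp_le_int[of "e r" "int r + 1"] by fastforce
qed

lemma expansion_unique:
  assumes "is_expansion d q" "is_expansion d' q"
  shows "d = d'"
proof -
  obtain n1 where n1: "\<And>t. \<bar>t\<bar> > int n1 \<Longrightarrow> d t = 0"
    using is_expansion_supp_bounded[OF assms(1)] by blast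
  obtain n2 where n2: "\<And>t. \<bar>t\<bar> > int n2 \<Longrightarrow> d' t = 0"
    using is_expansion_supp_bounded[OF assms(2)] by blast
  define n where "n = max n1 n2"
  have z: "d t = 0" "d' t = 0" if "\<bar>t\<bar> > int n" for t
    using n1[of t] n2[of t] that by (auto simp: n_def)
  have d: "d 0 = 0" "\<And>s::nat. 1 \<le> s \<Longrightarrow> 0 \<le> d (- int s) \<and> d (- int s) \<le> int s"
    "\<And>s::nat. 1 \<le> s \<Longrightarrow> 0 \<le> d (int s) \<and> d (int s) \<le> int s"
    using assms(1) unfolding is_expansion_def by blast+
  have d': "d' 0 = 0" "\<And>s::nat. 1 \<le> s \<Longrightarrow> 0 \<le> d' (- int s) \<and> d' (- int s) \<le> int s"
    "\<And>s::nat. 1 \<le> s \<Longrightarrow> 0 \<le> d' (int s) \<and> d' (int s) \<le> int s"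
    using assms(2) unfolding is_expansion_def by blast+
  define e where "e t = d t - d' t" for t
  have q: "q = (\<Sum>s=1..n. of_int (d (- int s)) * ((- 1) ^ s / fact (s + 1)))
       + (\<Sum>r=1..n. of_int (d (int r)) * ((- 1) ^ (r + 1) * fact r))"
    using assms(1) is_expansion_bounded[OF d z(1), where n = n] by blast
  have q': "q = (\<Sum>s=1..n. of_int (d' (- int s)) * ((- 1) ^ s / fact (s + 1)))
       + (\<Sum>r=1..n. of_int (d' (int r)) * ((- 1) ^ (r + 1) * fact r))"
    using assms(2) is_expansion_bounded[OF d' z(2), where n = n] by blast
  have "(\<Sum>s=1..n. of_int (e (- int s)) * ((- 1) ^ s / fact (s + 1)))
       + (\<Sum>r=1..n. of_int (e (int r)) * ((- 1) ^ (r + 1) * fact r)) = q - q"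
    by (subst (1) q, subst q') (simp add: e_def left_diff_distrib diff_divide_distrib sum_subtractf sum_negf)
  then have sum: "(\<Sum>s=1..n. of_int (e (- int s)) * ((- 1) ^ s / fact (s + 1)))
       = (of_int (- (\<Sum>r=1..n. e (int r) * ((- 1) ^ (r + 1) * fact r))) :: rat)"
    by (simp add: eq_neg_iff_add_eq_0)
  have eb: "\<bar>e (- int s)\<bar> \<le> int s" "\<bar>e (int s)\<bar> \<le> int s" if "1 \<le> s" for s
    using d(2,3)[OF that] d'(2,3)[OF that] by (auto simp: e_def)
  have neg: "e (- int s) = 0" if "1 \<le> s" "s \<le> n" for s
    using neg_digits_unique[of "\<lambda>s. e (- int s)", OF eb(1) sum that] by simp
  have "(of_int (\<Sum>r=1..n. e (int r) * ((- 1) ^ (r + 1) * fact r)) :: rat) = of_int 0"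
    using sum neg by simp
  then have "(\<Sum>r=1..n. e (int r) * ((- 1) ^ (r + 1) * fact r)) = 0"
    by (simp only: of_int_eq_iff)
  then have pos: "e (int r) = 0" if "1 \<le> r" "r \<le> n" for r
    using pos_digits_unique[of "\<lambda>r. e (int r)", OF eb(2) _ that] by simp
  show ?thesis
  proof
    fix t
    consider "\<bar>t\<bar> > int n" | "t = 0" | "t < 0" "\<bar>t\<bar> \<le> int n" | "t > 0" "\<bar>t\<bar> \<le> int n" by linarith
    then show "d t = d' t"
    proof cases
      case 1 then show ?thesis using z by simp
    next
      case 2 then show ?thesis using d d' by simp
    next
      case 3 then show ?thesis using neg[of "nat (- t)"] by (simp add: e_def)
    next
      case 4 then show ?thesis using pos[of "nat t"] by (simp add: e_def)
    qed
  qed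
qed

theorem ex1_expansion: "\<exists>!d. is_expansion d q"
  using expansion_exists expansion_unique by blast

end

theory Submission
  imports Defs
begin

text \<open>
  Cover the compact space by finitely many balls of radius \<open>\<epsilon> / 3\<close>; this turns \<open>f\<close> into a finite
  colouring of \<open>\<rat>\<^sup>l\<close>. The IP version of the Gallai--van der Waerden theorem, proved by colour focusing,
  gives a point \<open>\<alpha>\<close> and a finite non-empty set \<open>S\<close> of arbitrarily large indices such that all points
  \<open>\<alpha> + (\<Sum>i\<in>S. p / (2 i + 1)! + q (2 i + 1)!) v\<close> have the same colour. Summing over sets of
  indices, rather than multiplying by a common difference, makes the digits of
  \<open>\<beta> = (\<Sum>i\<in>S. 1 / (2 i + 1)!)\<close> and \<open>\<gamma> = (\<Sum>i\<in>S. (2 i + 1)!)\<close> visible: all of them are 0 or 1, located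
  at the positions \<open>- 2 i\<close> and \<open>2 i + 1\<close> for \<open>i \<in> S\<close>.
\<close>

subsection \<open>The IP van der Waerden theorem\<close>

text \<open>
  The base points and the index sets range over finite sets that depend on the colours but not on
  the colouring; without this uniformity the colour focusing below would not go through.
\<close>

definition ip_vdw :: "('t \<Rightarrow> nat \<Rightarrow> 'a::ab_group_add) \<Rightarrow> 't set \<Rightarrow> bool" where
  "ip_vdw g T \<longleftrightarrow> (\<forall>K. \<forall>C :: nat set. finite C \<longrightarrow>
     (\<exists>A N. finite A \<and> (\<forall>c. range c \<subseteq> C \<longrightarrow>
        (\<exists>a\<in>A. \<exists>S\<subseteq>{K..<N}. S \<noteq> {} \<and> (\<forall>t\<in>T. \<forall>t'\<in>T. c (a + sum (g t) S) = c (a + sum (g t') S))))))"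

text \<open>
  The set \<open>L\<close> consists of the colours focused at \<open>a\<close>. If the colour of \<open>a\<close> itself is not among
  them, a monochromatic configuration for the colouring by whole patterns adds it to \<open>L\<close>.
\<close>

lemma colour_focusing:
  fixes g :: "'t \<Rightarrow> nat \<Rightarrow> 'a::ab_group_add" and C :: "nat set"
  assumes vdw: "ip_vdw g T" and T: "finite T" "T \<noteq> {}" and C: "finite C"
  shows "\<exists>A N. finite A \<and> (\<forall>c. range c \<subseteq> C \<longrightarrow> (\<exists>a\<in>A.
     (\<exists>S\<subseteq>{K..<N}. S \<noteq> {} \<and> (\<forall>t\<in>T. c (a + sum (g t) S) = c a)) \<or>
     (\<exists>L\<subseteq>C. card L = s \<and> (\<forall>l\<in>L. \<exists>S\<subseteq>{K..<N}. S \<noteq> {} \<and> (\<forall>t\<in>T. c (a + sum (g t) S) = l)))))"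
proof (induction s)
  case 0
  show ?case
    by (rule exI[of _ "{0}"], rule exI[of _ 0], intro conjI allI impI bexI[of _ 0] disjI2 exI[of _ "{}"]) auto
next
  case (Suc s)
  then obtain A N where A: "finite A" and foc: "\<And>c. range c \<subseteq> C \<Longrightarrow> (\<exists>a\<in>A.
     (\<exists>S\<subseteq>{K..<N}. S \<noteq> {} \<and> (\<forall>t\<in>T. c (a + sum (g t) S) = c a)) \<or>
     (\<exists>L\<subseteq>C. card L = s \<and> (\<forall>l\<in>L. \<exists>S\<subseteq>{K..<N}. S \<noteq> {} \<and> (\<forall>t\<in>T. c (a + sum (g t) S) = l))))"
    by blast
  obtain t0 where t0: "t0 \<in> T" using T by blast
  \<comment> \<open>These are the offsets from a translate at which the colour must be recorded:
    base points of the induction hypothesis and the points focused on them.\<close>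
  define B where "B = A \<union> (\<lambda>(a, t, S). a + sum (g t) S) ` (A \<times> T \<times> Pow {K..<N})"
  have "finite B" using A T by (simp add: B_def)
  then obtain ds where ds: "set ds = B" using finite_list by blast
  \<comment> \<open>The pattern of colours on a translate of \<open>B\<close> is coded as one
    natural number, since \<open>ip_vdw\<close> speaks of colours in \<open>nat\<close>.\<close>
  define C' where "C' = (to_nat :: nat list \<Rightarrow> nat) ` {xs. set xs \<subseteq> C \<and> length xs = length ds}"
  have "finite C'" unfolding C'_def using C finite_lists_length_eq by blast
  \<comment> \<open>Starting at \<open>max K N\<close> keeps the new index sets disjoint from those
    of the induction hypothesis, so that sums over unions split.\<close>
  then obtain A' N' where A': "finite A'" and hom: "\<And>c. range c \<subseteq> C' \<Longrightarrow>
     (\<exists>a\<in>A'. \<exists>S\<subseteq>{max K N..<N'}. S \<noteq> {} \<and> (\<forall>t\<in>T. \<forall>t'\<in>T. c (a + sum (g t) S) = c (a + sum (g t') S)))"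
    using vdw unfolding ip_vdw_def by meson
  \<comment> \<open>The points \<open>a' + u\<close> are the new foci; the points
    \<open>x + u\<close> are for the case that the old focus already has its own colour on some
    configuration.\<close>
  define A'' where "A'' = (\<lambda>(a', u). a' + u) ` (A' \<times> A) \<union>
     (\<lambda>(a', S, u). a' + sum (g t0) S + u) ` (A' \<times> Pow {max K N..<N'} \<times> A)"
  have fin'': "finite A''" using A A' by (simp add: A''_def)
  show ?case
  proof (intro exI[of _ A''] exI[of _ "max N N'"] conjI allI impI fin'')
    fix c :: "'a \<Rightarrow> nat" assume c: "range c \<subseteq> C"
    define c' where "c' x = to_nat (map (\<lambda>d. c (x + d)) ds)" for x
    have "range c' \<subseteq> C'" unfolding c'_def C'_def using c by (intro image_subsetI imageI) auto
    from hom[OF this] obtain a' S' where a': "a' \<in> A'" and S': "S' \<subseteq> {max K N..<N'}" "S' \<noteq> {}"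
      and eq: "\<And>t t'. t \<in> T \<Longrightarrow> t' \<in> T \<Longrightarrow> c' (a' + sum (g t) S') = c' (a' + sum (g t') S')"
      by blast
    define x where "x = a' + sum (g t0) S'"
    \<comment> \<open>All translates chosen by \<open>S'\<close> carry the same pattern on
      \<open>B\<close>, so the one with \<open>t0\<close> can stand for each of them.\<close>
    have cx: "c (a' + sum (g t) S' + d) = c (x + d)" if "t \<in> T" "d \<in> B" for t d
      using eq[OF that(1) t0] that(2) by (auto simp: c'_def x_def ds)
    have "range (\<lambda>y. c (x + y)) \<subseteq> C" using c by auto
    from foc[OF this] obtain u where u: "u \<in> A" and disj:
      "(\<exists>S\<subseteq>{K..<N}. S \<noteq> {} \<and> (\<forall>t\<in>T. c (x + (u + sum (g t) S)) = c (x + u))) \<or>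
       (\<exists>L\<subseteq>C. card L = s \<and> (\<forall>l\<in>L. \<exists>S\<subseteq>{K..<N}. S \<noteq> {} \<and> (\<forall>t\<in>T. c (x + (u + sum (g t) S)) = l)))"
      by blast
    have xu: "x + u \<in> A''" using u a' S' by (force simp: A''_def x_def)
    have sub: "{K..<N} \<subseteq> {K..<max N N'}" by auto
    show "\<exists>a\<in>A''.
     (\<exists>S\<subseteq>{K..<max N N'}. S \<noteq> {} \<and> (\<forall>t\<in>T. c (a + sum (g t) S) = c a)) \<or>
     (\<exists>L\<subseteq>C. card L = Suc s \<and>
        (\<forall>l\<in>L. \<exists>S\<subseteq>{K..<max N N'}. S \<noteq> {} \<and> (\<forall>t\<in>T. c (a + sum (g t) S) = l)))"
    proof (cases "\<exists>S\<subseteq>{K..<N}. S \<noteq> {} \<and> (\<forall>t\<in>T. c (x + (u + sum (g t) S)) = c (x + u))")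
      case True
      then obtain S where "S \<subseteq> {K..<N}" "S \<noteq> {}" "\<forall>t\<in>T. c (x + u + sum (g t) S) = c (x + u)"
        by (auto simp: add.assoc)
      then show ?thesis using xu sub by (metis (no_types, lifting) subset_trans)
    next
      case False
      with disj obtain L where L: "L \<subseteq> C" "card L = s"
        and mono: "\<And>l. l \<in> L \<Longrightarrow> \<exists>S\<subseteq>{K..<N}. S \<noteq> {} \<and> (\<forall>t\<in>T. c (x + (u + sum (g t) S)) = l)"
        by blast
      have new: "c (x + u) \<notin> L" using mono False by blast
      let ?L = "insert (c (x + u)) L"
      \<comment> \<open>The focus moves from \<open>x + u\<close> back to \<open>a' + u\<close>:
        from there \<open>S'\<close> reaches the colour of the old focus, and
        \<open>S \<union> S'\<close> reaches each old colour in \<open>L\<close>.\<close>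
      have "a' + u \<in> A''" using u a' by (force simp: A''_def)
      moreover have "?L \<subseteq> C" using c L by auto
      moreover have "card ?L = Suc s" using new L finite_subset[OF L(1) C] by simp
      moreover have "\<exists>S\<subseteq>{K..<max N N'}. S \<noteq> {} \<and> (\<forall>t\<in>T. c (a' + u + sum (g t) S) = l)"
        if l: "l \<in> ?L" for l
      proof (cases "l = c (x + u)")
        case True
        have "c (a' + u + sum (g t) S') = l" if "t \<in> T" for t
          using cx[OF that, of u] u True by (simp add: B_def add_ac)
        moreover have "S' \<subseteq> {K..<max N N'}" using S' by auto
        ultimately show ?thesis using S' by blast
      next
        case False
        with l have "l \<in> L" by simp
        from mono[OF this] obtain S
          where S: "S \<subseteq> {K..<N}" "S \<noteq> {}" "\<And>t. t \<in> T \<Longrightarrow> c (x + (u + sum (g t) S)) = l"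
          by blast
        have "c (a' + u + sum (g t) (S \<union> S')) = l" if t: "t \<in> T" for t
        proof -
          have "u + sum (g t) S \<in> B"
            unfolding B_def using u t S(1) by (intro UnI2 image_eqI[where x = "(u, t, S)"]) auto
          from cx[OF t this] S(3)[OF t] have "c (a' + sum (g t) S' + (u + sum (g t) S)) = l" by simp
          moreover have "sum (g t) (S \<union> S') = sum (g t) S + sum (g t) S'"
          proof (rule sum.union_disjoint)
            show "finite S" "finite S'" using S(1) S'(1) finite_subset by blast+
            have "{K..<N} \<inter> {max K N..<N'} = {}" by auto
            then show "S \<inter> S' = {}" using S(1) S'(1) by blast
          qed
          ultimately show ?thesis by (simp add: add_ac)
        qed
        moreover have "S \<union> S' \<subseteq> {K..<max N N'}"
        proof -
          have "{max K N..<N'} \<subseteq> {K..<max N N'}" by auto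
          then show ?thesis using S(1) S'(1) sub by blast
        qed
        moreover have "S \<union> S' \<noteq> {}" using S(2) by simp
        ultimately show ?thesis by blast
      qed
      ultimately show ?thesis by blast
    qed
  qed
qed

text \<open>Subtracting \<open>g x\<close> turns the configuration of \<open>x\<close> into the base
  point itself. Colour focusing is then applied to the differences, which is why the hypothesis
  covers every \<open>h\<close>. As \<open>Suc (card C)\<close> distinct colours cannot be focused,
  the base point shares the colour of its configuration.\<close>

lemma ip_vdw_insert:
  fixes g :: "'t \<Rightarrow> nat \<Rightarrow> 'a::ab_group_add"
  assumes vdw: "\<And>h :: 't \<Rightarrow> nat \<Rightarrow> 'a. ip_vdw h T" and T: "finite T" "T \<noteq> {}"
  shows "ip_vdw g (insert x T)"
  unfolding ip_vdw_def
proof (intro allI impI)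
  fix K and C :: "nat set"
  assume C: "finite C"
  define h where "h t i = g t i - g x i" for t i
  have h: "sum (h t) S = sum (g t) S - sum (g x) S" for t S
    by (simp add: h_def sum_subtractf)
  obtain A N where A: "finite A" and foc: "\<And>c. range c \<subseteq> C \<Longrightarrow> (\<exists>a\<in>A.
     (\<exists>S\<subseteq>{K..<N}. S \<noteq> {} \<and> (\<forall>t\<in>T. c (a + sum (h t) S) = c a)) \<or>
     (\<exists>L\<subseteq>C. card L = Suc (card C) \<and>
        (\<forall>l\<in>L. \<exists>S\<subseteq>{K..<N}. S \<noteq> {} \<and> (\<forall>t\<in>T. c (a + sum (h t) S) = l))))"
    using colour_focusing[OF vdw[of h] T C, of K "Suc (card C)"] by blast
  \<comment> \<open>Shifting the base point undoes the subtraction: \<open>x\<close> now leads to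
    \<open>a\<close>, and each \<open>t\<close> in \<open>T\<close> to
    \<open>a + sum (h t) S\<close>.\<close>
  define A' where "A' = (\<lambda>(a, S). a - sum (g x) S) ` (A \<times> Pow {K..<N})"
  show "\<exists>A N. finite A \<and> (\<forall>c. range c \<subseteq> C \<longrightarrow> (\<exists>a\<in>A. \<exists>S\<subseteq>{K..<N}. S \<noteq> {} \<and>
     (\<forall>t\<in>insert x T. \<forall>t'\<in>insert x T. c (a + sum (g t) S) = c (a + sum (g t') S))))"
  proof (intro exI[of _ A'] exI[of _ N] conjI allI impI)
    show "finite A'" using A by (simp add: A'_def)
    fix c :: "'a \<Rightarrow> nat" assume c: "range c \<subseteq> C"
    have "\<not> (\<exists>L\<subseteq>C. card L = Suc (card C))"
      using card_mono[OF C] by (metis Suc_n_not_le_n)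
    with foc[OF c] obtain a S where aS: "a \<in> A" "S \<subseteq> {K..<N}" "S \<noteq> {}"
      and eq: "\<And>t. t \<in> T \<Longrightarrow> c (a + sum (h t) S) = c a"
      by metis
    have "c (a - sum (g x) S + sum (g t) S) = c a" if "t \<in> insert x T" for t
      using eq[of t] that by (auto simp: h algebra_simps)
    moreover have "a - sum (g x) S \<in> A'" using aS by (force simp: A'_def)
    ultimately show "\<exists>a\<in>A'. \<exists>S\<subseteq>{K..<N}. S \<noteq> {} \<and>
      (\<forall>t\<in>insert x T. \<forall>t'\<in>insert x T. c (a + sum (g t) S) = c (a + sum (g t') S))"
      using aS by metis
  qed
qed

lemma ip_vdw_finite:
  assumes "finite T" "T \<noteq> {}"
  shows "ip_vdw g T"
  using assms
proof (induction T arbitrary: g rule: finite_ne_induct)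
  case (singleton x)
  show ?case
    \<comment> \<open>With a single \<open>x\<close> there is nothing to compare;
      \<open>Suc K\<close> merely makes the interval \<open>{K..<Suc K}\<close> non-empty.\<close>
    unfolding ip_vdw_def by (intro allI impI exI[of _ "{0}"] exI[of _ "Suc K" for K]) force
next
  case (insert x T)
  show ?case
    using insert.IH insert.hyps(1,2) by (rule ip_vdw_insert)
qed

theorem ip_van_der_Waerden:
  fixes g :: "'t \<Rightarrow> nat \<Rightarrow> 'a::ab_group_add" and c :: "'a \<Rightarrow> 'c"
  assumes "finite T" "T \<noteq> {}" "finite (range c)"
  obtains a S where "finite S" "S \<noteq> {}" "S \<subseteq> {K..}"
    "\<And>t t'. t \<in> T \<Longrightarrow> t' \<in> T \<Longrightarrow> c (a + sum (g t) S) = c (a + sum (g t') S)"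
proof -
  obtain h :: "'c \<Rightarrow> nat" where h: "inj_on h (range c)"
    using finite_imp_inj_to_nat_seg[OF assms(3)] by blast
  have "finite (h ` range c)" "range (h \<circ> c) \<subseteq> h ` range c" using assms by auto
  then obtain a S N where S: "S \<subseteq> {K..<N}" "S \<noteq> {}"
    "\<forall>t\<in>T. \<forall>t'\<in>T. (h \<circ> c) (a + sum (g t) S) = (h \<circ> c) (a + sum (g t') S)"
    using ip_vdw_finite[OF assms(1,2), of g] unfolding ip_vdw_def by meson
  show thesis
  proof (rule that)
    show "finite S" using S(1) finite_subset by blast
    show "S \<subseteq> {K..}" using S(1) by auto
    show "c (a + sum (g t) S) = c (a + sum (g t') S)" if "t \<in> T" "t' \<in> T" for t t'
    proof (rule inj_onD[OF h])
      show "h (c (a + sum (g t) S)) = h (c (a + sum (g t') S))"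
        using S(3) that unfolding comp_def by blast
    qed auto
  qed (fact S(2))
qed

subsection \<open>Numbers with digits 0 and 1\<close>

lemma digit_dom_eqI:
  assumes "is_expansion d q"
  shows "digit_dom q = {t. t \<noteq> 0 \<and> d t \<noteq> 0}"
proof -
  have "digit q = d"
    unfolding digit_def using assms expansion_unique by blast
  then show ?thesis by (simp add: digit_dom_def)
qed

lemma digit_dom_sum_inverse_fact:
  assumes "finite S" "0 \<notin> S"
  shows "digit_dom (\<Sum>i\<in>S. 1 / fact (2 * i + 1)) = (\<lambda>i. - int (2 * i)) ` S"
proof -
  define D where "D = (\<lambda>i. - int (2 * i)) ` S"
  define d :: "int \<Rightarrow> int" where "d t = of_bool (t \<in> D)" for t
  have D0: "0 \<notin> D" using assms by (auto simp: D_def)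
  have d_neg: "d (- int s) = of_bool (s \<in> (\<lambda>i. 2 * i) ` S)" for s
    by (simp only: d_def D_def image_iff neg_equal_iff_equal of_nat_eq_iff)
  have neg: "{s. 1 \<le> s \<and> d (- int s) \<noteq> 0} = (\<lambda>i. 2 * i) ` S"
    using assms by (auto simp: d_neg Suc_le_eq intro!: Nat.gr0I)
  have pos: "d (int r) = 0" if "1 \<le> r" for r
    using that by (auto simp: d_def D_def)
  have "(\<Sum>s | 1 \<le> s \<and> d (- int s) \<noteq> 0. of_int (d (- int s)) * ((- 1) ^ s / fact (s + 1)) :: rat)
      = (\<Sum>i\<in>S. 1 / fact (2 * i + 1))"
    unfolding neg by (subst sum.reindex) (auto simp: inj_on_def d_def D_def)
  moreover have "{r. 1 \<le> r \<and> d (int r) \<noteq> 0} = {}" using pos by auto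
  moreover have "{t. d t \<noteq> 0} = D" by (auto simp: d_def)
  moreover have "finite D" using assms by (simp add: D_def)
  moreover have "d 0 = 0" using D0 by (simp add: d_def)
  moreover have "0 \<le> d t" "1 \<le> n \<Longrightarrow> d t \<le> int n" for t n by (simp_all add: d_def)
  ultimately have "is_expansion d (\<Sum>i\<in>S. 1 / fact (2 * i + 1))"
    unfolding is_expansion_def by (simp only: sum.empty add_0_left add_0_right simp_thms) blast
  from digit_dom_eqI[OF this] have "digit_dom (\<Sum>i\<in>S. 1 / fact (2 * i + 1)) = D"
    using D0 by (auto simp: d_def)
  then show ?thesis by (simp only: D_def)
qed

text \<open>At the odd position \<open>2 i + 1\<close> the sign is again positive, and distinct
  \<open>i\<close> give distinct positions; here \<open>i = 0\<close> is harmless.\<close>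

lemma digit_dom_sum_fact:
  assumes "finite S"
  shows "digit_dom (\<Sum>i\<in>S. fact (2 * i + 1)) = (\<lambda>i. int (2 * i + 1)) ` S"
proof -
  define D where "D = (\<lambda>i. int (2 * i + 1)) ` S"
  define d :: "int \<Rightarrow> int" where "d t = of_bool (t \<in> D)" for t
  have D0: "0 \<notin> D" by (auto simp: D_def)
  have d_pos: "d (int r) = of_bool (r \<in> (\<lambda>i. 2 * i + 1) ` S)" for r
    by (simp only: d_def D_def image_iff of_nat_eq_iff)
  have pos: "{r. 1 \<le> r \<and> d (int r) \<noteq> 0} = (\<lambda>i. 2 * i + 1) ` S"
    by (auto simp: d_pos)
  have neg: "d (- int s) = 0" if "1 \<le> s" for s
    using that by (auto simp: d_def D_def)
  have "(\<Sum>r | 1 \<le> r \<and> d (int r) \<noteq> 0. of_int (d (int r)) * ((- 1) ^ (r + 1) * fact r) :: rat)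
      = (\<Sum>i\<in>S. fact (2 * i + 1))"
    unfolding pos by (subst sum.reindex) (auto simp: inj_on_def d_def D_def)
  moreover have "{s. 1 \<le> s \<and> d (- int s) \<noteq> 0} = {}" using neg by auto
  moreover have "{t. d t \<noteq> 0} = D" by (auto simp: d_def)
  moreover have "finite D" using assms by (simp add: D_def)
  moreover have "d 0 = 0" using D0 by (simp add: d_def)
  moreover have "0 \<le> d t" "1 \<le> n \<Longrightarrow> d t \<le> int n" for t n by (simp_all add: d_def)
  ultimately have "is_expansion d (\<Sum>i\<in>S. fact (2 * i + 1))"
    unfolding is_expansion_def by (simp only: sum.empty add_0_left add_0_right simp_thms) blast
  from digit_dom_eqI[OF this] have "digit_dom (\<Sum>i\<in>S. fact (2 * i + 1)) = D"
    using D0 by (auto simp: d_def)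
  then show ?thesis by (simp only: D_def)
qed

text \<open>An integer has an expansion in signed factorials alone, and expansions are unique. This
  serves as the test for \<beta> not being an integer.\<close>

lemma dom_neg_of_int: "dom_neg (of_int M) = {}"
proof -
  obtain b n where b: "\<forall>i. 0 \<le> b i \<and> b i \<le> int i" "\<forall>i. i < 1 \<or> n < i \<longrightarrow> b i = 0"
    and M: "M * ((- 1) ^ (1 + 1) * fact 1) = (\<Sum>i=1..n. b i * ((- 1) ^ (i + 1) * fact i))"
    using pos_digits_exist[of 1 M] by blast
  define d where "d t = (if t < 0 then 0 else b (nat t))" for t
  have "is_expansion d (of_int M)"
  proof (subst is_expansion_bounded[where n = n])
    have "M = (\<Sum>r=1..n. d (int r) * ((- 1) ^ (r + 1) * fact r))"
      using M by (simp add: d_def)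
    then have "(of_int M :: rat) = of_int (\<Sum>r=1..n. d (int r) * ((- 1) ^ (r + 1) * fact r))"
      by (rule arg_cong)
    then show "(of_int M :: rat) = (\<Sum>s=1..n. of_int (d (- int s)) * ((- 1) ^ s / fact (s + 1)))
       + (\<Sum>r=1..n. of_int (d (int r)) * ((- 1) ^ (r + 1) * fact r))"
      by (simp add: d_def)
  qed (use b in \<open>auto simp: d_def\<close>)
  from digit_dom_eqI[OF this] show ?thesis
    by (auto simp: dom_neg_def d_def)
qed

section \<open>From equal colours to small diameter\<close>

text \<open>Radius \<open>\<epsilon> / 3\<close> bounds distances by
  \<open>2 * \<epsilon> / 3\<close>, which leaves room for the inequality to stay strict after
  taking the supremum.\<close>

lemma diameter_less:
  fixes A :: "'a::metric_space set"
  assumes "A \<subseteq> ball x (\<epsilon> / 3)" "A \<noteq> {}" "\<epsilon> > 0"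
  shows "diameter A < \<epsilon>"
proof -
  have "dist y z \<le> 2 * \<epsilon> / 3" if "y \<in> A" "z \<in> A" for y z
  proof -
    have "dist x y < \<epsilon> / 3" "dist x z < \<epsilon> / 3" using assms(1) that by auto
    then show ?thesis using dist_triangle3[of y z x] by linarith
  qed
  then have "(SUP (y, z)\<in>A \<times> A. dist y z) \<le> 2 * \<epsilon> / 3"
    using assms(2) by (intro cSUP_least) auto
  then have "diameter A \<le> 2 * \<epsilon> / 3"
    using assms(2) by (simp add: diameter_def)
  then show ?thesis using assms(3) by linarith
qed

theorem theorem5p1:
  fixes f :: "rat ^ 'l::finite \<Rightarrow> 'x::metric_space"
    and X :: "'x set"
    and k1 k2 \<epsilon> :: real
    and k :: nat
    and F :: "(rat ^ 'l) set"
  assumes "k1 < k2"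
    and "compact X"
    and "range f \<subseteq> X"
    and "\<epsilon> > 0"
    and "k \<ge> 1"
    and "finite F"
    and "F \<noteq> {}"
  shows "\<exists>\<alpha> :: rat ^ 'l. \<exists>\<beta> \<in> - \<int>. \<exists>\<gamma> \<in> \<int> - {0}.
           dom_pos \<beta> = {} \<and> dom_neg \<gamma> = {} \<and>
           real_of_int (Max (dom_neg \<beta>)) < k1 \<and> k2 < real_of_int (Min (dom_pos \<gamma>)) \<and>
           (\<forall>p q :: int. 0 \<le> p \<and> p \<le> int k \<and> 0 \<le> q \<and> q \<le> int k \<longrightarrow>
              diameter (f ` affine_image \<alpha> (of_int p * \<beta> + of_int q * \<gamma>) F) < \<epsilon>)"
proof -
  obtain Z where Z: "finite Z" "X \<subseteq> (\<Union>x\<in>Z. ball x (\<epsilon> / 3))"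
    using \<open>compact X\<close> \<open>\<epsilon> > 0\<close> compact_eq_totally_bounded[of X] by (metis divide_pos_pos zero_less_numeral)
  have "\<exists>x\<in>Z. f y \<in> ball x (\<epsilon> / 3)" for y
    using Z(2) \<open>range f \<subseteq> X\<close> by blast
  then obtain c where c: "\<And>y. c y \<in> Z" "\<And>y. f y \<in> ball (c y) (\<epsilon> / 3)"
    by metis
  have "finite (range c)" using c(1) Z(1) by (meson finite_subset image_subsetI)
  \<comment> \<open>All \<open>p\<close>, \<open>q\<close> and all points of \<open>F\<close> are
    treated at once, so that one \<alpha> and one \<open>S\<close> serve every pair.\<close>
  define T where "T = {0..int k} \<times> {0..int k} \<times> F"
  have T: "finite T" "T \<noteq> {}" using assms by (auto simp: T_def)
  define g :: "int \<times> int \<times> (rat ^ 'l) \<Rightarrow> nat \<Rightarrow> rat ^ 'l" where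
    "g = (\<lambda>(p, q, v) i. (of_int p * (1 / fact (2 * i + 1)) + of_int q * fact (2 * i + 1)) *s v)"
  \<comment> \<open>For \<open>i \<ge> K\<close> this gives \<open>- 2 i < k1\<close> and
    \<open>k2 < 2 i + 1\<close>; the added 1 also keeps 0 out of \<open>S\<close>.\<close>
  define K where "K = nat \<lceil>\<bar>k1\<bar> + \<bar>k2\<bar>\<rceil> + 1"
  have K: "real K > \<bar>k1\<bar> + \<bar>k2\<bar>" unfolding K_def by linarith
  obtain \<alpha> S where S: "finite S" "S \<noteq> {}" "S \<subseteq> {K..}"
    and mono: "\<And>t t'. t \<in> T \<Longrightarrow> t' \<in> T \<Longrightarrow> c (\<alpha> + sum (g t) S) = c (\<alpha> + sum (g t') S)"
    using ip_van_der_Waerden[OF T \<open>finite (range c)\<close>] by metis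
  define \<beta> :: rat where "\<beta> = (\<Sum>i\<in>S. 1 / fact (2 * i + 1))"
  define \<gamma> :: rat where "\<gamma> = (\<Sum>i\<in>S. fact (2 * i + 1))"
  have "0 \<notin> S" using S(3) by (auto simp: K_def)
  then have dom_\<beta>: "digit_dom \<beta> = (\<lambda>i. - int (2 * i)) ` S"
    unfolding \<beta>_def using S(1) by (rule digit_dom_sum_inverse_fact[rotated])
  have dom_\<gamma>: "digit_dom \<gamma> = (\<lambda>i. int (2 * i + 1)) ` S"
    unfolding \<gamma>_def using S(1) by (rule digit_dom_sum_fact)
  have neg_\<beta>: "dom_neg \<beta> = (\<lambda>i. - int (2 * i)) ` S"
    using \<open>0 \<notin> S\<close> by (auto simp: dom_neg_def dom_\<beta> intro!: Nat.gr0I)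
  have pos_\<gamma>: "dom_pos \<gamma> = (\<lambda>i. int (2 * i + 1)) ` S"
    by (auto simp: dom_pos_def dom_\<gamma>)
  have sum_g: "sum (g (p, q, v)) S = (of_int p * \<beta> + of_int q * \<gamma>) *s v" for p q v
    by (simp only: g_def prod.case \<beta>_def \<gamma>_def sum_distrib_left flip: sum.distrib vec.scale_sum_left)
  show ?thesis
  proof (rule exI[of _ \<alpha>], rule bexI[of _ \<beta>], rule bexI[of _ \<gamma>], intro conjI allI impI)
    show "dom_pos \<beta> = {}" by (auto simp: dom_pos_def dom_\<beta>)
    show "dom_neg \<gamma> = {}" by (auto simp: dom_neg_def dom_\<gamma>)
    have "Max (dom_neg \<beta>) \<in> dom_neg \<beta>" using S by (intro Max_in) (auto simp: neg_\<beta>)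
    then obtain i where "i \<in> S" "Max (dom_neg \<beta>) = - int (2 * i)" unfolding neg_\<beta> by auto
    moreover from this S(3) have "real K \<le> real i" by auto
    ultimately show "real_of_int (Max (dom_neg \<beta>)) < k1" using K by simp
    have "Min (dom_pos \<gamma>) \<in> dom_pos \<gamma>" using S by (intro Min_in) (auto simp: pos_\<gamma>)
    then obtain j where "j \<in> S" "Min (dom_pos \<gamma>) = int (2 * j + 1)" unfolding pos_\<gamma> by auto
    moreover from this S(3) have "real K \<le> real j" by auto
    ultimately show "k2 < real_of_int (Min (dom_pos \<gamma>))" using K by simp
    have "\<gamma> > 0" unfolding \<gamma>_def using S by (intro sum_pos) auto
    moreover have "\<gamma> = of_int (\<Sum>i\<in>S. fact (2 * i + 1))" by (simp only: \<gamma>_def of_int_sum of_int_fact)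
    ultimately show "\<gamma> \<in> \<int> - {0}" by (metis Diff_iff Ints_of_int less_irrefl singletonD)
    \<comment> \<open>An integer would have empty \<open>dom_neg\<close>, whereas \<open>S\<close>
      is non-empty.\<close>
    show "\<beta> \<in> - \<int>" using S(2) neg_\<beta> dom_neg_of_int by (auto elim!: Ints_cases)
  next
    fix p q :: int
    assume pq: "0 \<le> p \<and> p \<le> int k \<and> 0 \<le> q \<and> q \<le> int k"
    \<comment> \<open>The point \<open>v\<close> only fixes a reference: the centre chosen for it
      serves the whole image of \<open>F\<close>.\<close>
    obtain v where v: "v \<in> F" using \<open>F \<noteq> {}\<close> by blast
    let ?z = "c (\<alpha> + sum (g (p, q, v)) S)"
    have "f (\<alpha> + (of_int p * \<beta> + of_int q * \<gamma>) *s w) \<in> ball ?z (\<epsilon> / 3)" if "w \<in> F" for w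
    proof -
      have "c (\<alpha> + sum (g (p, q, w)) S) = ?z"
        using pq v that by (intro mono) (auto simp: T_def)
      then show ?thesis using c(2)[of "\<alpha> + sum (g (p, q, w)) S"] unfolding sum_g by simp
    qed
    then show "diameter (f ` affine_image \<alpha> (of_int p * \<beta> + of_int q * \<gamma>) F) < \<epsilon>"
      using v \<open>\<epsilon> > 0\<close> by (intro diameter_less[where x = ?z]) (auto simp: affine_image_def)
  qed
qed

end
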